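(* Let $\dim E=n-1$. Consider the zero charge superizations $\mathfrak g=\mathfrak g_{\bar0}+\mathfrak g_{\bar1}=\mathfrak{heis}_b+S$ of the Heisenberg algebra $\mathfrak{heis}_b=E^*+E+\mathbb R\mathrm p$ such that, for all $e\in E$ and $Q,\tilde Q\in S$, $$\rho(e)=\begin{pmatrix}0&\rho_{12}(e)\\0&0\end{pmatrix},\qquad [Q,\tilde Q]=\mathrm p(Q,\tilde Q)\,\mathrm p,$$ where $\rho$ is the adjoint action of $\mathfrak{heis}_b$ on $S$ and $\mathrm p(\cdot,\cdot)$ is a symmetric bilinear form on $S$. Every such superization is uniquely determined by $$\rho_{12}\in\mathrm{Hom}_{\mathbb R}(E,\mathrm{End}_{\mathbb R}(S_{0,n-1})),\qquad \mathrm p_{-+}\in\mathrm{Bil}_{\mathbb R}(S_{0,n-1})^{\tau\sigma=-1},\qquad \mathrm p_{++}\in\mathrm{Bil}_{\mathbb R}(S_{0,n-1}),$$ where $\mathrm p_{++}$ is a symmetric bilinear form on $S_{0,n-1}$ and the bilinear form $\mathrm p_{-+}(\rho_{12}(e)\cdot,\cdot)\in\mathrm{Bil}_{\mathbb R}(S_{0,n-1})$ is skew-symmetric for every $e\in E$.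
   Context: $E=\mathbb R^{0,n-1}$ ($n\ge2$) is an $(n-1)$-dimensional real vector space with a negative definite inner product $\langle\cdot,\cdot\rangle$; $e^\flat=\langle e,\cdot\rangle\in E^*$. $b$ is a non-degenerate symmetric bilinear form on $E$ and $B\in\mathrm{End}_{\mathbb R}(E)$ is defined by $b(\cdot,\cdot)=-\langle B\cdot,\cdot\rangle$. The Heisenberg algebra $\mathfrak{heis}_b=E^*+E+\mathbb R\mathrm p$ has as only non-trivial brackets $[e^\flat,f]=b(e,f)\mathrm p$ ($e,f\in E$). $\mathrm{Cl}_{0,n-1}$ is the Clifford algebra of $E$ with convention $v^2=-\langle v,v\rangle$, $S_{0,n-1}$ a real irreducible $\mathrm{Cl}_{0,n-1}$-module, on which vectors of $E$ act by Clifford multiplication; $\mathfrak{so}(E)\hookrightarrow\mathrm{Cl}_{0,n-1}$ via $v\wedge w\mapsto\frac14[v,w]$. An $\mathfrak{so}(E)$-invariant bilinear form $\Gamma$ on $S_{0,n-1}$ is admissible if: (1) Clifford multiplication by vectors is $\Gamma$-symmetric (type $\tau=+1$) or $\Gamma$-skew-symmetric ($\tau=-1$); (2) $\Gamma$ is symmetric ($\sigma=+1$) or skew-symmetric ($\sigma=-1$); (3) if $S_{0,n-1}=S^+_{0,n-1}+S^-_{0,n-1}$ is reducible as $\mathfrak{so}(E)$-module, the irreducible summands (semi-spinors) are either mutually orthogonal or isotropic for $\Gamma$. $\mathrm{Bil}_{\mathbb R}(S_{0,n-1})^{\tau\sigma=-1}$ is the space spanned by the admissible bilinear forms with $\tau\sigma=-1$.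 Let $\mathfrak m=E+\mathbb R\mathrm p+\mathbb R\mathrm q$ be Minkowski space ($\mathrm p,\mathrm q$ isotropic, orthogonal to $E$, $\langle\mathrm p,\mathrm q\rangle=1$) and $S=S_{1,n}$ the real irreducible $\mathrm{Cl}(\mathfrak m)$-module, identified as a vector space with $S=S_-+S_+=S_{0,n-1}+S_{0,n-1}$ (endomorphisms written as $2\times2$ block matrices) in such a way that $\mathrm p\wedge e\in\mathfrak{so}(\mathfrak m)$ acts as $\begin{pmatrix}0&\sqrt2\,e\\0&0\end{pmatrix}$. A representation $\rho:\mathfrak{heis}_b\to\mathfrak{gl}_{\mathbb R}(S)$ is spin if $\rho(e^\flat)=\begin{pmatrix}0&\sqrt2\,Be\\0&0\end{pmatrix}$ for all $e\in E$; it has zero charge if $\rho(\mathrm p)=0$. A superization of $\mathfrak{heis}_b$ is a Lie superalgebra $\mathfrak g=\mathfrak g_{\bar0}+\mathfrak g_{\bar1}$ with $\mathfrak g_{\bar0}=\mathfrak{heis}_b$, $\mathfrak g_{\bar1}=S$, such that the adjoint action of $\mathfrak g_{\bar0}$ on $\mathfrak g_{\bar1}$ is a spin representation; it is called zero charge if this representation is. $\mathrm p_{--}:S_-\vee S_-\to\mathbb R$, $\mathrm p_{-+}:S_-\otimes S_+\to\mathbb R$ and $\mathrm p_{++}:S_+\vee S_+\to\mathbb R$ denote the restrictions of the symmetric form $\mathrm p(\cdot,\cdot)$ on $S$ ($S_\mp$ being identified with $S_{0,n-1}$); for the superizations in question $\mathrm p_{--}=0$, so that $\mathrm p(Q,Q)=2\,\mathrm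 p_{-+}(Q_-,Q_+)+\mathrm p_{++}(Q_+,Q_+)$ for $Q=Q_-+Q_+$.
   Formalization: The semi-spinor summands in the definition of admissible forms are also required to be interchanged by Clifford multiplication; for equivalent summands (e.g. dim E = 6 or 7) other splittings into irreducible summands make the claim false. *)

theory Defs
  imports "HOL-Analysis.Analysis"
begin

(* The space E = R^{0,n-1} is a type 'e of class euclidean_space, so n - 1 = DIM('e) >= 1;
   its negative definite product is minus the inner product of the class.
   The dual E^* is the type 'e \<Rightarrow>\<^sub>L real: every linear functional on 'e is bounded. *)

definition neg_inner :: "'e::euclidean_space \<Rightarrow> 'e \<Rightarrow> real"
  where "neg_inner x y = - (x \<bullet> y)"

lift_definition flat :: "'e::euclidean_space \<Rightarrow> 'e \<Rightarrow>\<^sub>L real" is neg_inner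
  unfolding neg_inner_def by (intro bounded_linear_minus bounded_linear_inner_right)

definition sharp :: "('e::euclidean_space \<Rightarrow>\<^sub>L real) \<Rightarrow> 'e"
  where "sharp = inv flat"

lemma bij_flat: "bij (flat :: 'e::euclidean_space \<Rightarrow> 'e \<Rightarrow>\<^sub>L real)"
proof (rule bijI)
  show "inj (flat :: 'e \<Rightarrow> 'e \<Rightarrow>\<^sub>L real)"
  proof (rule injI)
    fix x y :: 'e assume "flat x = flat y"
    then have "neg_inner x z = neg_inner y z" for z
      by (metis flat.rep_eq)
    then show "x = y"
      unfolding neg_inner_def by (metis neg_equal_iff_equal vector_eq_rdot)
  qed
  have "\<exists>x. \<alpha> = flat x" for \<alpha> :: "'e \<Rightarrow>\<^sub>L real"
  proof
    let ?x = "- (\<Sum>i\<in>Basis. blinfun_apply \<alpha> i *\<^sub>R i)"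
    show "\<alpha> = flat ?x"
    proof (rule blinfun_euclidean_eqI)
      fix i :: 'e assume "i \<in> Basis"
      then show "blinfun_apply \<alpha> i = blinfun_apply (flat ?x) i"
        by (simp add: flat.rep_eq neg_inner_def)
    qed
  qed
  then show "surj (flat :: 'e \<Rightarrow> 'e \<Rightarrow>\<^sub>L real)"
    unfolding surj_def by blast
qed

lemma sharp_flat [simp]: "sharp (flat e) = e"
  unfolding sharp_def by (rule inv_f_f[OF bij_is_inj[OF bij_flat]])

definition nondeg_sym_bilinear :: "('v::real_vector \<Rightarrow> 'v \<Rightarrow> real) \<Rightarrow> bool"
  where "nondeg_sym_bilinear b \<longleftrightarrow>
    bilinear b \<and> (\<forall>x y. b x y = b y x) \<and> (\<forall>x. (\<forall>y. b x y = 0) \<longrightarrow> x = 0)"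


section \<open>Clifford modules and spinors\<close>

(* A module over the Clifford algebra Cl(V,g) is given, by the presentation of Cl(V,g) as the
   tensor algebra of V modulo v \<otimes> v = - g(v,v) 1, by the action \<gamma> of the generators
   v in V.  A subspace is a Cl(V,g)-submodule iff it is stable under all \<gamma> v. *)
definition clifford_module ::
    "('v::real_vector \<Rightarrow> 'v \<Rightarrow> real) \<Rightarrow> ('v \<Rightarrow> 's::real_vector \<Rightarrow> 's) \<Rightarrow> bool"
  where "clifford_module g \<gamma> \<longleftrightarrow>
    bilinear \<gamma> \<and> (\<forall>v s. \<gamma> v (\<gamma> v s) = - g v v *\<^sub>R s)"

definition invariant_subspace :: "('s::real_vector \<Rightarrow> 's) set \<Rightarrow> 's set \<Rightarrow> bool"
  where "invariant_subspace A U \<longleftrightarrow> subspace U \<and> (\<forall>f\<in>A. f ` U \<subseteq> U)"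

definition irreducible_on :: "('s::real_vector \<Rightarrow> 's) set \<Rightarrow> 's set \<Rightarrow> bool"
  where "irreducible_on A U \<longleftrightarrow> invariant_subspace A U \<and> U \<noteq> {0} \<and>
    (\<forall>W. invariant_subspace A W \<and> W \<subseteq> U \<longrightarrow> W = {0} \<or> W = U)"

definition irreducible_clifford_module ::
    "('v::real_vector \<Rightarrow> 'v \<Rightarrow> real) \<Rightarrow> ('v \<Rightarrow> 's::real_vector \<Rightarrow> 's) \<Rightarrow> bool"
  where "irreducible_clifford_module g \<gamma> \<longleftrightarrow>
    clifford_module g \<gamma> \<and> irreducible_on (range \<gamma>) UNIV"

(* The action of v \<and> w in so(V), embedded in the Clifford algebra as [v,w]/4. *)
definition so_act :: "('v \<Rightarrow> 's::real_vector \<Rightarrow> 's) \<Rightarrow> 'v \<Rightarrow> 'v \<Rightarrow> 's \<Rightarrow> 's"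
  where "so_act \<gamma> v w s = (1/4) *\<^sub>R (\<gamma> v (\<gamma> w s) - \<gamma> w (\<gamma> v s))"

(* The bivectors v \<and> w span so(V), so they suffice to test invariance. *)
definition so_ops :: "('v \<Rightarrow> 's::real_vector \<Rightarrow> 's) \<Rightarrow> ('s \<Rightarrow> 's) set"
  where "so_ops \<gamma> = {so_act \<gamma> v w | v w. True}"

(* Splitting of a reducible spinor module into semi-spinors.  That Clifford multiplication
   interchanges the summands is automatic if they are inequivalent.  If they are equivalent
   as so(V)-modules (e.g. V = E of dimension 6 or 7), there are also decompositions into
   irreducible submodules without this property.  They are excluded: relative to them the
   orthogonal/isotropic dichotomy below can fail for too many forms (dimension 7: forms with
   \<tau>\<sigma> = -1 are then no longer sums of admissible ones). *)
definition semi_spinors ::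
    "('v \<Rightarrow> 's::real_vector \<Rightarrow> 's) \<Rightarrow> 's set \<Rightarrow> 's set \<Rightarrow> bool"
  where "semi_spinors \<gamma> Sp Sm \<longleftrightarrow>
    irreducible_on (so_ops \<gamma>) Sp \<and> irreducible_on (so_ops \<gamma>) Sm \<and>
    Sp \<inter> Sm = {0} \<and> (\<forall>s. \<exists>x\<in>Sp. \<exists>y\<in>Sm. s = x + y) \<and>
    (\<forall>v. \<gamma> v ` Sp \<subseteq> Sm \<and> \<gamma> v ` Sm \<subseteq> Sp)"

lemma semi_spinors_exist:
  fixes \<gamma> :: "'e::euclidean_space \<Rightarrow> 's::real_vector \<Rightarrow> 's"
  assumes irr: "irreducible_clifford_module neg_inner \<gamma>"
    and red: "\<not> irreducible_on (so_ops \<gamma>) UNIV"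
  shows "\<exists>Sp Sm. semi_spinors \<gamma> Sp Sm"
proof -
  have bil: "bilinear \<gamma>" and sq: "\<gamma> v (\<gamma> v s) = (v \<bullet> v) *\<^sub>R s" for v s
    using irr unfolding irreducible_clifford_module_def clifford_module_def neg_inner_def by auto
  have lin: "linear (\<gamma> v)" for v using bil by (simp add: bilinear_def)
  have cl: "W = {0} \<or> W = UNIV" if "subspace W" "\<And>v s. s \<in> W \<Longrightarrow> \<gamma> v s \<in> W" for W
    using irr that unfolding irreducible_clifford_module_def irreducible_on_def invariant_subspace_def
    by auto
  have polar: "\<gamma> v (\<gamma> w s) + \<gamma> w (\<gamma> v s) = (2 * (v \<bullet> w)) *\<^sub>R s" for v w s
    using sq[of "v + w" s] sq[of v s] sq[of w s]
    by (simp add: bilinear_ladd[OF bil] bilinear_radd[OF bil] inner_simps inner_commute algebra_simps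
          flip: scaleR_2)
  have even: "\<gamma> v (\<gamma> w s) \<in> W" if W: "invariant_subspace (so_ops \<gamma>) W" and s: "s \<in> W" for v w s W
  proof -
    have "so_act \<gamma> v w s \<in> W"
      using W s unfolding invariant_subspace_def so_ops_def by blast
    moreover have "\<gamma> v (\<gamma> w s) = 2 *\<^sub>R so_act \<gamma> v w s + (v \<bullet> w) *\<^sub>R s"
    proof -
      have "2 *\<^sub>R \<gamma> v (\<gamma> w s) = 2 *\<^sub>R (2 *\<^sub>R so_act \<gamma> v w s + (v \<bullet> w) *\<^sub>R s)"
        using polar[of v w s] by (simp add: so_act_def algebra_simps scaleR_2)
      then show ?thesis by simp
    qed
    ultimately show ?thesis
      using W s by (simp add: invariant_subspace_def subspace_add subspace_scale)
  qed
  have so: "invariant_subspace (so_ops \<gamma>) W"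
    if "subspace W" "\<And>v w s. s \<in> W \<Longrightarrow> \<gamma> v (\<gamma> w s) \<in> W" for W
    using that unfolding invariant_subspace_def so_ops_def so_act_def
    by (auto intro!: subspace_scale subspace_diff)
  obtain u :: 'e where "u \<in> Basis" by (meson nonempty_Basis ex_in_conv)
  then have u: "\<gamma> u (\<gamma> u s) = s" for s using sq[of u s] by simp
  let ?P = "\<lambda>W. invariant_subspace (so_ops \<gamma>) W \<and> W \<noteq> {0} \<and> W \<noteq> UNIV"
  have sub: "subspace W" "subspace (\<gamma> u ` W)" if "?P W" for W
    using that lin[of u] by (auto simp: invariant_subspace_def linear_subspace_image)
  have total: "\<exists>x\<in>W. \<exists>y\<in>\<gamma> u ` W. s = x + y" if W: "?P W" for W s
  proof -
    let ?T = "{x + y | x y. x \<in> W \<and> y \<in> \<gamma> u ` W}"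
    have "?T = {0} \<or> ?T = UNIV"
    proof (rule cl)
      show "subspace ?T" using sub[OF W] by (rule subspace_sums)
    next
      fix v s assume "s \<in> ?T"
      then obtain x y where xy: "x \<in> W" "y \<in> W" "s = x + \<gamma> u y" by auto
      then have "\<gamma> v s = \<gamma> v (\<gamma> u y) + \<gamma> u (\<gamma> u (\<gamma> v x))"
        by (simp add: u bilinear_radd[OF bil])
      then show "\<gamma> v s \<in> ?T" using xy W even by blast
    qed
    moreover have "W \<subseteq> ?T"
    proof
      fix x assume "x \<in> W"
      then show "x \<in> ?T" using subspace_0[OF sub(2)[OF W]] by force
    qed
    moreover have "\<not> W \<subseteq> {0}" using W subspace_0[OF sub(1)[OF W]] by auto
    ultimately have "?T = UNIV" by auto
    then have "s \<in> ?T" by simp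
    then show ?thesis by auto
  qed
  have disj: "W \<inter> \<gamma> u ` W = {0}" if W: "?P W" for W
  proof -
    have "W \<inter> \<gamma> u ` W = {0} \<or> W \<inter> \<gamma> u ` W = UNIV"
    proof (rule cl)
      show "subspace (W \<inter> \<gamma> u ` W)" using sub[OF W] by (rule subspace_inter)
    next
      fix v s assume s: "s \<in> W \<inter> \<gamma> u ` W"
      then have "\<gamma> v s \<in> W" using W even by blast
      moreover have "\<gamma> v s = \<gamma> u (\<gamma> u (\<gamma> v s))" by (simp add: u)
      ultimately show "\<gamma> v s \<in> W \<inter> \<gamma> u ` W" using W even s by blast
    qed
    then show ?thesis using W by auto
  qed
  have irred: "irreducible_on (so_ops \<gamma>) W" if W: "?P W" for W
    unfolding irreducible_on_def
  proof (intro conjI allI impI)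
    fix W' assume W': "invariant_subspace (so_ops \<gamma>) W' \<and> W' \<subseteq> W"
    show "W' = {0} \<or> W' = W"
    proof (rule disjCI)
      assume "W' \<noteq> W"
      show "W' = {0}"
      proof (rule ccontr)
        assume "W' \<noteq> {0}"
        then have P': "?P W'" using W W' by auto
        have "x \<in> W'" if x: "x \<in> W" for x
        proof -
          obtain a c where ac: "a \<in> W'" "c \<in> \<gamma> u ` W'" "x = a + c" using total[OF P'] by blast
          then have "c = x - a" by simp
          then have "c \<in> W \<inter> \<gamma> u ` W"
            using ac x W' subspace_diff[OF sub(1)[OF W]] by blast
          then show ?thesis using disj[OF W] ac by auto
        qed
        then show False using W' \<open>W' \<noteq> W\<close> by blast
      qed
    qed
  qed (use W in auto)
  have "invariant_subspace (so_ops \<gamma>) UNIV" by (simp add: invariant_subspace_def)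
  moreover have "(UNIV :: 's set) \<noteq> {0}"
    using irr unfolding irreducible_clifford_module_def irreducible_on_def by auto
  ultimately obtain W where W: "?P W" using red unfolding irreducible_on_def by auto
  have "?P (\<gamma> u ` W)"
  proof (intro conjI)
    show "invariant_subspace (so_ops \<gamma>) (\<gamma> u ` W)"
    proof (rule so[OF sub(2)[OF W]])
      fix v w s assume "s \<in> \<gamma> u ` W"
      then obtain y where "y \<in> W" "s = \<gamma> u y" by blast
      then have "\<gamma> u (\<gamma> v (\<gamma> w s)) \<in> W" using W even by blast
      then show "\<gamma> v (\<gamma> w s) \<in> \<gamma> u ` W" by (metis u imageI)
    qed
    show "\<gamma> u ` W \<noteq> UNIV" using disj[OF W] W by auto
    show "\<gamma> u ` W \<noteq> {0}"
      using total[OF W] W subspace_0[OF sub(1)[OF W]] by (metis add.right_neutral UNIV_eq_I singletonD)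
  qed
  then have "semi_spinors \<gamma> W (\<gamma> u ` W)"
    unfolding semi_spinors_def
  proof (intro conjI allI)
    fix v
    show "\<gamma> v ` W \<subseteq> \<gamma> u ` W" using W even by (metis image_subsetI imageI u)
    show "\<gamma> v ` (\<gamma> u ` W) \<subseteq> W" using W even by blast
  qed (use irred disj[OF W] total[OF W] W in auto)
  then show ?thesis by blast
qed


section \<open>Admissible bilinear forms\<close>

definition admissible ::
    "('v \<Rightarrow> 's::real_vector \<Rightarrow> 's) \<Rightarrow> 's set \<Rightarrow> 's set \<Rightarrow> real \<Rightarrow> real \<Rightarrow> ('s \<Rightarrow> 's \<Rightarrow> real) \<Rightarrow> bool"
  where "admissible \<gamma> Sp Sm \<tau> \<sigma> \<Gamma> \<longleftrightarrow>
    bilinear \<Gamma> \<and>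
    (\<forall>f\<in>so_ops \<gamma>. \<forall>s t. \<Gamma> (f s) t + \<Gamma> s (f t) = 0) \<and>
    \<tau> \<in> {1, -1} \<and> (\<forall>v s t. \<Gamma> (\<gamma> v s) t = \<tau> * \<Gamma> s (\<gamma> v t)) \<and>
    \<sigma> \<in> {1, -1} \<and> (\<forall>s t. \<Gamma> s t = \<sigma> * \<Gamma> t s) \<and>
    (\<not> irreducible_on (so_ops \<gamma>) UNIV \<longrightarrow>
       (\<forall>s\<in>Sp. \<forall>t\<in>Sm. \<Gamma> s t = 0 \<and> \<Gamma> t s = 0) \<or>
       ((\<forall>s\<in>Sp. \<forall>t\<in>Sp. \<Gamma> s t = 0) \<and> (\<forall>s\<in>Sm. \<forall>t\<in>Sm. \<Gamma> s t = 0)))"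

(* The linear span of the admissible forms with \<tau>\<sigma> = -1; spelled out because function types
   carry no real_vector structure. *)
definition Bil_minus ::
    "('v \<Rightarrow> 's::real_vector \<Rightarrow> 's) \<Rightarrow> 's set \<Rightarrow> 's set \<Rightarrow> ('s \<Rightarrow> 's \<Rightarrow> real) set"
  where "Bil_minus \<gamma> Sp Sm = {\<Gamma>. \<exists>(k::nat) c F.
    (\<forall>i<k. \<exists>\<tau> \<sigma>. admissible \<gamma> Sp Sm \<tau> \<sigma> (F i) \<and> \<tau> * \<sigma> = -1) \<and>
    \<Gamma> = (\<lambda>s t. \<Sum>i<k. c i * F i s t)}"


section \<open>Minkowski space and its spinor module\<close>

(* Coordinates (e, x, y) stand for e + x p + y q. *)
type_synonym 'e mink = "'e \<times> real \<times> real"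

definition mink_inner :: "'e::euclidean_space mink \<Rightarrow> 'e mink \<Rightarrow> real"
  where "mink_inner = (\<lambda>(e, x, y) (e', x', y'). neg_inner e e' + x * y' + y * x')"

(* A pair (s, t) in S = 's \<times> 's has components s in S_- and t in S_+; in the block matrices
   of endomorphisms of S the first row and column belong to S_-. *)
definition upper_right :: "('s::real_vector \<Rightarrow> 's) \<Rightarrow> 's \<times> 's \<Rightarrow> 's \<times> 's"
  where "upper_right A Q = (A (snd Q), 0)"

definition minkowski_spinors ::
    "('e::euclidean_space \<Rightarrow> 's::real_vector \<Rightarrow> 's) \<Rightarrow> ('e mink \<Rightarrow> 's \<times> 's \<Rightarrow> 's \<times> 's) \<Rightarrow> bool"
  where "minkowski_spinors \<gamma> \<delta> \<longleftrightarrow>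
    irreducible_clifford_module mink_inner \<delta> \<and>
    (\<forall>e. so_act \<delta> (0, 1, 0) (e, 0, 0) = upper_right (\<lambda>s. sqrt 2 *\<^sub>R \<gamma> e s))"

(* The compatible Cl(m)-module structure on S = 's \<times> 's always exists. *)
lemma minkowski_spinors_exist:
  fixes \<gamma> :: "'e::euclidean_space \<Rightarrow> 's::real_vector \<Rightarrow> 's"
  assumes irr: "irreducible_clifford_module neg_inner \<gamma>"
  shows "\<exists>\<delta>. minkowski_spinors \<gamma> \<delta>"
proof -
  have bil: "bilinear \<gamma>" and sq: "\<gamma> v (\<gamma> v s) = (v \<bullet> v) *\<^sub>R s" for v s
    using irr unfolding irreducible_clifford_module_def clifford_module_def neg_inner_def by auto
  note bs = bilinear_ladd[OF bil] bilinear_radd[OF bil] bilinear_lmul[OF bil] bilinear_rmul[OF bil]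
    bilinear_lzero[OF bil] bilinear_rzero[OF bil] bilinear_lneg[OF bil] bilinear_rneg[OF bil]
    bilinear_lsub[OF bil] bilinear_rsub[OF bil]
  let ?r = "sqrt 2"
  define \<delta> :: "'e mink \<Rightarrow> 's \<times> 's \<Rightarrow> 's \<times> 's" where
    "\<delta> = (\<lambda>(e, x, y) (s, t). (\<gamma> e s - (2 * ?r * x) *\<^sub>R t, - \<gamma> e t + (y * ?r / 2) *\<^sub>R s))"
  have bd: "bilinear \<delta>"
    unfolding bilinear_def by (auto intro!: linearI simp: \<delta>_def bs algebra_simps add_divide_distrib split: prod.splits)
  have "\<delta> v (\<delta> v Q) = - mink_inner v v *\<^sub>R Q" for v Q
    by (cases v; cases Q)
      (simp add: \<delta>_def mink_inner_def neg_inner_def bs sq algebra_simps)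
  then have cm: "clifford_module mink_inner \<delta>" using bd by (simp add: clifford_module_def)
  have cl: "U = {0} \<or> U = UNIV" if "subspace U" "\<And>v s. s \<in> U \<Longrightarrow> \<gamma> v s \<in> U" for U
    using irr that unfolding irreducible_clifford_module_def irreducible_on_def invariant_subspace_def
    by auto
  have ne: "(UNIV :: 's set) \<noteq> {0}"
    using irr unfolding irreducible_clifford_module_def irreducible_on_def by auto
  have ir: "W = {0} \<or> W = UNIV" if W: "subspace W" "\<And>v Q. Q \<in> W \<Longrightarrow> \<delta> v Q \<in> W" for W
  proof -
    have down: "(0, s) \<in> W" if "(s, t) \<in> W" for s t
    proof -
      have "\<delta> (0, 0, ?r) (s, t) \<in> W" using W(2) that by blast
      then show ?thesis by (simp add: \<delta>_def bs)
    qed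
    have up: "(t, 0) \<in> W" if "(s, t) \<in> W" for s t
    proof -
      have "\<delta> (0, - ?r / 4, 0) (s, t) \<in> W" using W(2) that by blast
      then show ?thesis by (simp add: \<delta>_def bs)
    qed
    let ?U = "{s. (s, 0) \<in> W}"
    have "?U = {0} \<or> ?U = UNIV"
    proof (rule cl)
      show "subspace ?U"
        using W(1) unfolding subspace_def
        by (auto simp: zero_prod_def) (metis add_Pair add_0, metis scaleR_Pair scaleR_zero_right)
    next
      fix v s assume "s \<in> ?U"
      then have "\<delta> (v, 0, 0) (s, 0) \<in> W" using W(2) by blast
      then show "\<gamma> v s \<in> ?U" by (simp add: \<delta>_def bs)
    qed
    then show ?thesis
    proof
      assume U: "?U = {0}"
      have "s = 0 \<and> t = 0" if "(s, t) \<in> W" for s t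
        using U up[OF that] up[OF down[OF that]] by blast
      then have "W \<subseteq> {0}" by (auto simp: zero_prod_def)
      then show ?thesis using subspace_0[OF W(1)] by auto
    next
      assume U: "?U = UNIV"
      have "(s, t) \<in> W" for s t
      proof -
        have "(s, 0) \<in> W" "(t, 0) \<in> W" using U by auto
        then have "(s, 0) + (0, t) \<in> W" using down subspace_add[OF W(1)] by blast
        then show ?thesis by simp
      qed
      then show ?thesis by auto
    qed
  qed
  have "(UNIV :: ('s \<times> 's) set) \<noteq> {0}"
    using ne by (metis UNIV_I UNIV_eq_I prod.inject singletonD singletonI zero_prod_def)
  then have "irreducible_on (range \<delta>) UNIV"
    unfolding irreducible_on_def
  proof (intro conjI allI impI)
    fix W assume "invariant_subspace (range \<delta>) W \<and> W \<subseteq> UNIV"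
    then show "W = {0} \<or> W = UNIV"
      by (intro ir) (unfold invariant_subspace_def, blast+)
  qed (auto simp: invariant_subspace_def)
  moreover have "so_act \<delta> (0, 1, 0) (e, 0, 0) = upper_right (\<lambda>s. ?r *\<^sub>R \<gamma> e s)" for e
    by (rule ext) (auto simp: so_act_def upper_right_def \<delta>_def bs algebra_simps simp flip: scaleR_left.add)
  ultimately show ?thesis
    using cm unfolding minkowski_spinors_def irreducible_clifford_module_def by blast
qed


section \<open>The Heisenberg algebra and its superizations\<close>

(* (\<alpha>, e, c) stands for \<alpha> + e + c p. *)
type_synonym 'e heis = "('e \<Rightarrow>\<^sub>L real) \<times> 'e \<times> real"

definition heis_p :: "'e::euclidean_space heis"
  where "heis_p = (0, 0, 1)"

definition heis_bracket ::
    "('e::euclidean_space \<Rightarrow> 'e \<Rightarrow> real) \<Rightarrow> 'e heis \<Rightarrow> 'e heis \<Rightarrow> 'e heis"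
  where "heis_bracket b = (\<lambda>(\<alpha>, e, c) (\<alpha>', e', c').
    (b (sharp \<alpha>) e' - b (sharp \<alpha>') e) *\<^sub>R heis_p)"

lemma heis_bracket_flat:
  assumes "bilinear b"
  shows "heis_bracket b (flat e, 0, 0) (0, f, 0) = b e f *\<^sub>R heis_p"
proof -
  have "flat (0 :: 'a) = 0"
    by (rule blinfun_eqI) (simp add: flat.rep_eq neg_inner_def)
  then have "sharp 0 = (0 :: 'a)" by (metis sharp_flat)
  then show ?thesis using assms by (simp add: heis_bracket_def bilinear_lzero)
qed

(* Lie superalgebra structures on a space presented as (even part) \<times> (odd part). *)
definition homogeneous :: "nat \<Rightarrow> ('g::real_vector \<times> 's::real_vector) set"
  where "homogeneous i = {x. if even i then snd x = 0 else fst x = 0}"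

definition lie_superalgebra ::
    "('g::real_vector \<times> 's::real_vector \<Rightarrow> 'g \<times> 's \<Rightarrow> 'g \<times> 's) \<Rightarrow> bool"
  where "lie_superalgebra br \<longleftrightarrow>
    bilinear br \<and>
    (\<forall>i j. \<forall>x\<in>homogeneous i. \<forall>y\<in>homogeneous j.
       br x y \<in> homogeneous (i + j) \<and> br x y = - ((-1) ^ (i * j) *\<^sub>R br y x) \<and>
       (\<forall>z. br x (br y z) = br (br x y) z + (-1) ^ (i * j) *\<^sub>R br y (br x z)))"

(* The adjoint action of the even part on the odd part. *)
definition ad_odd ::
    "('g::real_vector \<times> 's::real_vector \<Rightarrow> 'g \<times> 's \<Rightarrow> 'g \<times> 's) \<Rightarrow> 'g \<Rightarrow> 's \<Rightarrow> 's"
  where "ad_odd br x Q = snd (br (x, 0) (0, Q))"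

definition spin_rep ::
    "('e::euclidean_space \<Rightarrow> 's::real_vector \<Rightarrow> 's) \<Rightarrow> ('e \<Rightarrow> 'e) \<Rightarrow>
     ('e heis \<Rightarrow> 's \<times> 's \<Rightarrow> 's \<times> 's) \<Rightarrow> bool"
  where "spin_rep \<gamma> B \<rho> \<longleftrightarrow>
    (\<forall>e. \<rho> (flat e, 0, 0) = upper_right (\<lambda>s. sqrt 2 *\<^sub>R \<gamma> (B e) s))"

definition zero_charge :: "('e::euclidean_space heis \<Rightarrow> 's::real_vector \<Rightarrow> 's) \<Rightarrow> bool"
  where "zero_charge \<rho> \<longleftrightarrow> \<rho> heis_p = (\<lambda>Q. 0)"

definition superization ::
    "('e::euclidean_space \<Rightarrow> 's::real_vector \<Rightarrow> 's) \<Rightarrow> ('e \<Rightarrow> 'e \<Rightarrow> real) \<Rightarrow> ('e \<Rightarrow> 'e) \<Rightarrow>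
     ('e heis \<times> ('s \<times> 's) \<Rightarrow> 'e heis \<times> ('s \<times> 's) \<Rightarrow> 'e heis \<times> ('s \<times> 's)) \<Rightarrow> bool"
  where "superization \<gamma> b B br \<longleftrightarrow>
    lie_superalgebra br \<and>
    (\<forall>x y. br (x, 0) (y, 0) = (heis_bracket b x y, 0)) \<and>
    spin_rep \<gamma> B (ad_odd br)"

definition special_superizations ::
    "('e::euclidean_space \<Rightarrow> 's::real_vector \<Rightarrow> 's) \<Rightarrow> ('e \<Rightarrow> 'e \<Rightarrow> real) \<Rightarrow> ('e \<Rightarrow> 'e) \<Rightarrow>
     ('e heis \<times> ('s \<times> 's) \<Rightarrow> 'e heis \<times> ('s \<times> 's) \<Rightarrow> 'e heis \<times> ('s \<times> 's)) set"
  where "special_superizations \<gamma> b B = {br.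
    superization \<gamma> b B br \<and> zero_charge (ad_odd br) \<and>
    (\<exists>\<rho>12. bilinear \<rho>12 \<and> (\<forall>e. ad_odd br (0, e, 0) = upper_right (\<rho>12 e))) \<and>
    (\<exists>P. bilinear P \<and> (\<forall>Q Q'. P Q Q' = P Q' Q) \<and>
       (\<forall>Q Q'. br (0, Q) (0, Q') = (P Q Q' *\<^sub>R heis_p, 0)))}"

definition rho12_of ::
    "('e::euclidean_space heis \<times> ('s::real_vector \<times> 's) \<Rightarrow> 'e heis \<times> ('s \<times> 's) \<Rightarrow> 'e heis \<times> ('s \<times> 's))
     \<Rightarrow> 'e \<Rightarrow> 's \<Rightarrow> 's"
  where "rho12_of br e s = fst (ad_odd br (0, e, 0) (0, s))"

definition p_form ::
    "('e::euclidean_space heis \<times> ('s::real_vector \<times> 's) \<Rightarrow> 'e heis \<times> ('s \<times> 's) \<Rightarrow> 'e heis \<times> ('s \<times> 's))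
     \<Rightarrow> 's \<times> 's \<Rightarrow> 's \<times> 's \<Rightarrow> real"
  where "p_form br Q Q' = snd (snd (fst (br (0, Q) (0, Q'))))"

definition p_minus_plus ::
    "('e::euclidean_space heis \<times> ('s::real_vector \<times> 's) \<Rightarrow> 'e heis \<times> ('s \<times> 's) \<Rightarrow> 'e heis \<times> ('s \<times> 's))
     \<Rightarrow> 's \<Rightarrow> 's \<Rightarrow> real"
  where "p_minus_plus br s t = p_form br (s, 0) (0, t)"

definition p_plus_plus ::
    "('e::euclidean_space heis \<times> ('s::real_vector \<times> 's) \<Rightarrow> 'e heis \<times> ('s \<times> 's) \<Rightarrow> 'e heis \<times> ('s \<times> 's))
     \<Rightarrow> 's \<Rightarrow> 's \<Rightarrow> real"
  where "p_plus_plus br s t = p_form br (0, s) (0, t)"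

end

theory Submission
  imports Defs
begin

text \<open>
  Everything rests on two observations.

  First, the Jacobi identity. All brackets of a special superization lie in the line of
  \<open>p\<close> plus \<open>S_-\<close>, and \<open>p\<close> is central and acts by zero on spinors. Hence the only
  condition that the Jacobi identity imposes is the invariance of the form \<open>P\<close> with
  \<open>[Q, Q'] = P Q Q' p\<close> under the even part. The operators of the even part have a single block
  \<open>r x : S_+ \<rightarrow> S_-\<close>. On a pair from \<open>S_-\<close> and \<open>S_+\<close> invariance under \<open>\<alpha> \<in> E^*\<close> forces
  \<open>p_--\<close> to vanish, because Clifford multiplication by a nonzero vector is invertible and
  \<open>B\<close> is onto, as \<open>b\<close> is non-degenerate. What remains, on two elements of \<open>S_+\<close>, says that \<open>p_-+ (r x s) t\<close> is
  skew in \<open>s\<close> and \<open>t\<close> for all \<open>x\<close>: for \<open>x \<in> E\<close> this is the condition on \<open>\<rho>12\<close>, and for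
  \<open>x \<in> E^*\<close> it says that \<open>p_-+\<close> is skew after Clifford multiplication by any vector.
  The lemmas \<open>super_bracket_special\<close> and \<open>special_superization_eq_super_bracket\<close> are the two
  directions of this equivalence.

  Second, the span of the admissible forms with \<open>\<tau>\<sigma> = -1\<close> consists exactly of the bilinear
  forms that are skew after Clifford multiplication (\<open>Bil_minus_iff\<close>). An admissible form has
  \<open>\<Gamma> (\<gamma> v s) t = \<tau> \<Gamma> s (\<gamma> v t) = \<tau>\<sigma> \<Gamma> (\<gamma> v t) s\<close>, which gives one inclusion. Conversely, if
  \<open>\<Gamma>\<close> is skew in this sense, so is its transpose; this makes the symmetric part of
  \<open>\<Gamma>\<close> a form of type \<open>\<tau> = -1\<close> and the skew part a form of type \<open>\<tau> = 1\<close>. Forms of definite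
  type are invariant, since commutators of two vectors act by skew operators. If there are
  semi-spinors, each of the two parts is split once more, into the part that is preserved and
  the part that is reversed by the parity operator of the splitting. Parity anticommutes with
  vectors, so both pieces keep their types, and they satisfy the orthogonality and the
  isotropy condition, respectively.
\<close>

section \<open>Forms that are skew after Clifford multiplication\<close>

definition clifford_skew :: "('v \<Rightarrow> 's::real_vector \<Rightarrow> 's) \<Rightarrow> ('s \<Rightarrow> 's \<Rightarrow> real) \<Rightarrow> bool"
  where "clifford_skew \<gamma> \<Gamma> \<longleftrightarrow> bilinear \<Gamma> \<and> (\<forall>v s t. \<Gamma> (\<gamma> v s) t = - \<Gamma> (\<gamma> v t) s)"

lemma bilinear_real_lincomb:
  fixes \<Gamma> \<Delta> :: "'a::real_vector \<Rightarrow> 'b::real_vector \<Rightarrow> real"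
  assumes "bilinear \<Gamma>" "bilinear \<Delta>"
  shows "bilinear (\<lambda>s t. a * \<Gamma> s t + c * \<Delta> s t)"
  unfolding bilinear_def
  by (auto intro!: linearI simp: assms[THEN bilinear_ladd] assms[THEN bilinear_radd]
      assms[THEN bilinear_lmul] assms[THEN bilinear_rmul] algebra_simps)

lemma bilinear_flip: "bilinear \<Gamma> \<Longrightarrow> bilinear (\<lambda>s t. \<Gamma> t s)"
  by (simp add: bilinear_def)

lemma bilinear_compose_linear:
  assumes "bilinear \<Gamma>" "linear f" "linear g"
  shows "bilinear (\<lambda>s t. \<Gamma> (f s) (g t))"
  using assms linear_compose[of f "\<lambda>s. \<Gamma> s (g t)" for t] linear_compose[of g "\<Gamma> (f s)" for s]
  unfolding bilinear_def by (simp add: o_def)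

text \<open>The transpose of a form that is skew after Clifford multiplication has the same property. With
  \<open>\<gamma> v s\<close> and \<open>\<gamma> v t\<close> inserted into the defining identity, the square of \<open>\<gamma> v\<close> contributes the
  factor \<open>v \<bullet> v\<close> on both sides, and it can be cancelled.\<close>

lemma clifford_skew_transpose:
  fixes \<gamma> :: "'e::euclidean_space \<Rightarrow> 's::real_vector \<Rightarrow> 's"
  assumes cm: "clifford_module neg_inner \<gamma>" and sk: "clifford_skew \<gamma> \<Gamma>"
  shows "\<Gamma> s (\<gamma> v t) = - \<Gamma> t (\<gamma> v s)"
proof (cases "v = 0")
  case True
  then show ?thesis
    using cm sk by (simp add: clifford_module_def clifford_skew_def bilinear_lzero bilinear_rzero)
next
  case False
  have sq: "\<gamma> v (\<gamma> v s) = (v \<bullet> v) *\<^sub>R s" for s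
    using cm by (simp add: clifford_module_def neg_inner_def)
  have bil: "bilinear \<Gamma>" using sk by (simp add: clifford_skew_def)
  have "\<Gamma> (\<gamma> v (\<gamma> v s)) (\<gamma> v t) = - \<Gamma> (\<gamma> v (\<gamma> v t)) (\<gamma> v s)"
    using sk unfolding clifford_skew_def by blast
  then have "(v \<bullet> v) * \<Gamma> s (\<gamma> v t) = (v \<bullet> v) * - \<Gamma> t (\<gamma> v s)"
    by (simp add: sq bilinear_lmul[OF bil])
  with False show ?thesis by (simp only: mult_cancel_left inner_eq_zero_iff) simp
qed

text \<open>Invariance follows from the type \<open>\<tau>\<close>: moving two vectors across \<open>\<Gamma>\<close> costs \<open>\<tau>\<^sup>2 = 1\<close> and
  reverses their order, so a commutator changes its sign. By the symmetry \<open>\<sigma>\<close>, orthogonality of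
  the semi-spinors has to be tested on one side only.\<close>

lemma admissibleI:
  fixes \<gamma> :: "'v \<Rightarrow> 's::real_vector \<Rightarrow> 's"
  assumes bil: "bilinear \<Gamma>"
    and \<tau>: "\<tau> \<in> {1, -1}" "\<And>v s t. \<Gamma> (\<gamma> v s) t = \<tau> * \<Gamma> s (\<gamma> v t)"
    and \<sigma>: "\<sigma> \<in> {1, -1}" "\<And>s t. \<Gamma> s t = \<sigma> * \<Gamma> t s"
    and semi: "\<not> irreducible_on (so_ops \<gamma>) UNIV \<Longrightarrow>
       (\<forall>s\<in>Sp. \<forall>t\<in>Sm. \<Gamma> s t = 0) \<or>
       ((\<forall>s\<in>Sp. \<forall>t\<in>Sp. \<Gamma> s t = 0) \<and> (\<forall>s\<in>Sm. \<forall>t\<in>Sm. \<Gamma> s t = 0))"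
  shows "admissible \<gamma> Sp Sm \<tau> \<sigma> \<Gamma>"
proof -
  have "\<Gamma> (\<gamma> v (\<gamma> w s)) t = \<Gamma> s (\<gamma> w (\<gamma> v t))" for v w s t
  proof -
    have "\<Gamma> (\<gamma> v (\<gamma> w s)) t = \<tau> * (\<tau> * \<Gamma> s (\<gamma> w (\<gamma> v t)))"
      by (metis \<tau>(2))
    then show ?thesis using \<tau>(1) by auto
  qed
  then have "\<forall>f\<in>so_ops \<gamma>. \<forall>s t. \<Gamma> (f s) t + \<Gamma> s (f t) = 0"
    by (auto simp: so_ops_def so_act_def bilinear_lmul[OF bil] bilinear_rmul[OF bil]
        bilinear_lsub[OF bil] bilinear_rsub[OF bil] simp flip: add_divide_distrib)
  moreover have "\<Gamma> t s = 0" if "\<Gamma> s t = 0" for s t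
    using that \<sigma>(2)[of t s] by simp
  ultimately show ?thesis
    using assms unfolding admissible_def by blast
qed

text \<open>The parity operator of a splitting into semi-spinors is \<open>2 \<pi> - 1\<close> for the projection \<open>\<pi>\<close>
  onto the first summand. It anticommutes with vectors because they exchange the summands.\<close>

lemma semi_spinors_parity:
  fixes \<gamma> :: "'e::euclidean_space \<Rightarrow> 's::real_vector \<Rightarrow> 's"
  assumes bil: "bilinear \<gamma>" and ss: "semi_spinors \<gamma> Sp Sm"
  obtains \<epsilon> where "linear \<epsilon>" "\<And>s. s \<in> Sp \<Longrightarrow> \<epsilon> s = s" "\<And>s. s \<in> Sm \<Longrightarrow> \<epsilon> s = - s"
    "\<And>v s. \<epsilon> (\<gamma> v s) = - \<gamma> v (\<epsilon> s)"
proof -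
  have sub: "subspace Sp" "subspace Sm" and int: "Sp \<inter> Sm = {0}"
    and tot: "\<exists>x\<in>Sp. \<exists>y\<in>Sm. s = x + y"
    and swap: "x \<in> Sp \<Longrightarrow> \<gamma> v x \<in> Sm" "x \<in> Sm \<Longrightarrow> \<gamma> v x \<in> Sp" for s v x
    using ss unfolding semi_spinors_def irreducible_on_def invariant_subspace_def by blast+
  obtain \<pi> where \<pi>: "\<And>s. \<pi> s \<in> Sp" "\<And>s. s - \<pi> s \<in> Sm"
    using tot by (metis add_diff_cancel_left')
  (* Linearity of the projection and its behaviour under vectors both come from uniqueness
     of the decomposition. *)
  have uniq: "\<pi> s = x" if "x \<in> Sp" "s - x \<in> Sm" for s x
  proof -
    have "\<pi> s - x \<in> Sp" using \<pi> that sub by (simp add: subspace_diff)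
    moreover have "\<pi> s - x = (s - x) - (s - \<pi> s)" by simp
    then have "\<pi> s - x \<in> Sm" using \<pi> that sub by (metis subspace_diff)
    ultimately have "\<pi> s - x = 0" using int by blast
    then show ?thesis by simp
  qed
  have add: "\<pi> (s + t) = \<pi> s + \<pi> t" for s t
  proof (rule uniq)
    have "s + t - (\<pi> s + \<pi> t) = (s - \<pi> s) + (t - \<pi> t)" by simp
    then show "s + t - (\<pi> s + \<pi> t) \<in> Sm" using \<pi> sub by (metis subspace_add)
  qed (use \<pi> sub in \<open>simp add: subspace_add\<close>)
  have scale: "\<pi> (c *\<^sub>R s) = c *\<^sub>R \<pi> s" for c s
    by (rule uniq) (use \<pi> sub in \<open>auto simp: subspace_scale simp flip: scaleR_diff_right\<close>)
  have cliff: "\<pi> (\<gamma> v s) = \<gamma> v (s - \<pi> s)" for v s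
    by (rule uniq) (use \<pi> swap in \<open>auto simp flip: bilinear_rsub[OF bil]\<close>)
  show thesis
  proof
    let ?\<epsilon> = "\<lambda>s. 2 *\<^sub>R \<pi> s - s"
    show "linear ?\<epsilon>"
      by (rule linearI) (simp_all add: add scale algebra_simps)
    show p: "?\<epsilon> s = s" if "s \<in> Sp" for s
      using uniq[of s s] that sub by (simp add: subspace_0 scaleR_2)
    show m: "?\<epsilon> s = - s" if "s \<in> Sm" for s
      using uniq[of 0 s] that sub by (simp add: subspace_0)
    show "?\<epsilon> (\<gamma> v s) = - \<gamma> v (?\<epsilon> s)" for v s
      by (simp add: cliff bilinear_rsub[OF bil] bilinear_radd[OF bil] algebra_simps scaleR_2)
  qed
qed

lemma Bil_minus_admissible:
  assumes "admissible \<gamma> Sp Sm \<tau> \<sigma> \<Gamma>" "\<tau> * \<sigma> = -1"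
  shows "\<Gamma> \<in> Bil_minus \<gamma> Sp Sm"
proof -
  have "\<Gamma> = (\<lambda>s t. \<Sum>i<Suc 0. 1 * \<Gamma> s t)" by simp
  then show ?thesis
    unfolding Bil_minus_def using assms
    by (intro CollectI exI[of _ "Suc 0"] exI[of _ "\<lambda>_. 1"] exI[of _ "\<lambda>_. \<Gamma>"]) blast
qed

lemma Bil_minus_lincomb:
  assumes "\<Gamma> \<in> Bil_minus \<gamma> Sp Sm" "\<Delta> \<in> Bil_minus \<gamma> Sp Sm"
  shows "(\<lambda>s t. a * \<Gamma> s t + d * \<Delta> s t) \<in> Bil_minus \<gamma> Sp Sm"
proof -
  let ?adm = "\<lambda>\<Gamma>. \<exists>\<tau> \<sigma>. admissible \<gamma> Sp Sm \<tau> \<sigma> \<Gamma> \<and> \<tau> * \<sigma> = -1"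
  obtain k c F l c' F' where
    F: "\<And>i. i < k \<Longrightarrow> ?adm (F i)" "\<Gamma> = (\<lambda>s t. \<Sum>i<(k::nat). c i * F i s t)" and
    F': "\<And>i. i < l \<Longrightarrow> ?adm (F' i)" "\<Delta> = (\<lambda>s t. \<Sum>i<(l::nat). c' i * F' i s t)"
    using assms unfolding Bil_minus_def by blast
  let ?c = "\<lambda>i. if i < k then a * c i else d * c' (i - k)"
  let ?F = "\<lambda>i. if i < k then F i else F' (i - k)"
  have "(\<Sum>i<k + l. ?c i * ?F i s t) = a * \<Gamma> s t + d * \<Delta> s t" for s t
  proof -
    have "(\<Sum>i<k + n. ?c i * ?F i s t)
        = (\<Sum>i<k. a * c i * F i s t) + (\<Sum>i<n. d * c' i * F' i s t)" for n
      by (induction n) simp_all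
    then show ?thesis by (simp add: F F' sum_distrib_left mult.assoc)
  qed
  moreover have "?adm (?F i)" if "i < k + l" for i
    using F(1)[of i] F'(1)[of "i - k"] that by (cases "i < k") (auto simp: not_less)
  ultimately show ?thesis
    unfolding Bil_minus_def by (intro CollectI exI[of _ "k + l"] exI[of _ ?c] exI[of _ ?F]) auto
qed

lemma admissible_clifford_skew:
  assumes adm: "admissible \<gamma> Sp Sm \<tau> \<sigma> \<Gamma>" and "\<tau> * \<sigma> = -1"
  shows "clifford_skew \<gamma> \<Gamma>"
proof -
  have "\<Gamma> (\<gamma> v s) t = \<tau> * \<Gamma> s (\<gamma> v t)" "\<Gamma> s (\<gamma> v t) = \<sigma> * \<Gamma> (\<gamma> v t) s" for v s t
    using adm unfolding admissible_def by blast+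
  then have "\<Gamma> (\<gamma> v s) t = (\<tau> * \<sigma>) * \<Gamma> (\<gamma> v t) s" for v s t
    by (metis mult.assoc)
  then have "\<forall>v s t. \<Gamma> (\<gamma> v s) t = - \<Gamma> (\<gamma> v t) s"
    unfolding assms(2) mult_minus1 by blast
  moreover have "bilinear \<Gamma>" using adm unfolding admissible_def by blast
  ultimately show ?thesis unfolding clifford_skew_def by blast
qed

lemma Bil_minus_clifford_skew:
  assumes "\<Gamma> \<in> Bil_minus \<gamma> Sp Sm"
  shows "clifford_skew \<gamma> \<Gamma>"
proof -
  obtain k c F where F: "\<And>i. i < (k::nat) \<Longrightarrow> clifford_skew \<gamma> (F i)"
    and \<Gamma>: "\<Gamma> = (\<lambda>s t. \<Sum>i<k. c i * F i s t)"
    using assms admissible_clifford_skew unfolding Bil_minus_def by blast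
  have "bilinear (F i)" if "i < k" for i
    using F[OF that] by (simp add: clifford_skew_def)
  note bil = this[THEN bilinear_ladd] this[THEN bilinear_radd] this[THEN bilinear_lmul]
    this[THEN bilinear_rmul]
  have "bilinear \<Gamma>"
    unfolding bilinear_def \<Gamma>
    by (auto intro!: linearI sum.cong simp: bil algebra_simps sum_distrib_left simp flip: sum.distrib)
  moreover have "\<Gamma> (\<gamma> v s) t = - \<Gamma> (\<gamma> v t) s" for v s t
    unfolding \<Gamma> sum_negf[symmetric]
  proof (rule sum.cong)
    fix i assume "i \<in> {..<k}"
    then have "F i (\<gamma> v s) t = - F i (\<gamma> v t) s" using F unfolding clifford_skew_def by blast
    then show "c i * F i (\<gamma> v s) t = - (c i * F i (\<gamma> v t) s)" by simp
  qed simp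
  ultimately show ?thesis unfolding clifford_skew_def by blast
qed

text \<open>Any form of definite types lies in the span, although it may mix the two alternatives for the
  semi-spinors: averaging over the parity operator separates the part that pairs each summand
  with itself from the part that pairs the two summands with each other.\<close>

lemma symmetric_types_in_Bil_minus:
  fixes \<gamma> :: "'e::euclidean_space \<Rightarrow> 's::real_vector \<Rightarrow> 's"
  assumes \<gamma>: "bilinear \<gamma>"
    and semi: "\<not> irreducible_on (so_ops \<gamma>) UNIV \<Longrightarrow> semi_spinors \<gamma> Sp Sm"
    and bil: "bilinear \<Gamma>"
    and \<tau>: "\<tau> \<in> {1, -1}" "\<And>v s t. \<Gamma> (\<gamma> v s) t = \<tau> * \<Gamma> s (\<gamma> v t)"
    and \<sigma>: "\<sigma> \<in> {1, -1}" "\<And>s t. \<Gamma> s t = \<sigma> * \<Gamma> t s"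
    and \<tau>\<sigma>: "\<tau> * \<sigma> = -1"
  shows "\<Gamma> \<in> Bil_minus \<gamma> Sp Sm"
proof (cases "irreducible_on (so_ops \<gamma>) UNIV")
  case True
  then have "admissible \<gamma> Sp Sm \<tau> \<sigma> \<Gamma>" by (intro admissibleI assms) simp
  then show ?thesis using \<tau>\<sigma> by (rule Bil_minus_admissible)
next
  case False
  obtain \<epsilon> where \<epsilon>: "linear \<epsilon>" "\<And>s. s \<in> Sp \<Longrightarrow> \<epsilon> s = s" "\<And>s. s \<in> Sm \<Longrightarrow> \<epsilon> s = - s"
    "\<And>v s. \<epsilon> (\<gamma> v s) = - \<gamma> v (\<epsilon> s)"
    using semi_spinors_parity[OF \<gamma> semi[OF False]] by metis
  (* The sign c = 1 gives the part that makes the summands orthogonal,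
     c = -1 the part for which they are isotropic. *)
  define \<Delta> where "\<Delta> = (\<lambda>c s t. 1 * \<Gamma> s t + c * \<Gamma> (\<epsilon> s) (\<epsilon> t))"
  note bs = bilinear_lneg[OF bil] bilinear_rneg[OF bil]
  have \<Delta>: "\<Delta> c \<in> Bil_minus \<gamma> Sp Sm" if c: "c \<in> {1, -1}" for c
  proof (rule Bil_minus_admissible[OF admissibleI \<tau>\<sigma>])
    show "bilinear (\<Delta> c)"
      unfolding \<Delta>_def by (rule bilinear_real_lincomb[OF bil bilinear_compose_linear[OF bil \<epsilon>(1) \<epsilon>(1)]])
    show "\<Delta> c (\<gamma> v s) t = \<tau> * \<Delta> c s (\<gamma> v t)" for v s t
      using \<tau>(2)[of v s t] \<tau>(2)[of v "\<epsilon> s" "\<epsilon> t"] by (simp add: \<Delta>_def \<epsilon> bs algebra_simps)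
    show "\<Delta> c s t = \<sigma> * \<Delta> c t s" for s t
      unfolding \<Delta>_def \<sigma>(2)[of s t] \<sigma>(2)[of "\<epsilon> s" "\<epsilon> t"] by (simp add: algebra_simps)
    show "(\<forall>s\<in>Sp. \<forall>t\<in>Sm. \<Delta> c s t = 0) \<or>
      (\<forall>s\<in>Sp. \<forall>t\<in>Sp. \<Delta> c s t = 0) \<and> (\<forall>s\<in>Sm. \<forall>t\<in>Sm. \<Delta> c s t = 0)"
      using c by (auto simp: \<Delta>_def \<epsilon> bs)
  qed (use \<tau>(1) \<sigma>(1) in auto)
  have "(\<lambda>s t. (1/2) * \<Delta> 1 s t + (1/2) * \<Delta> (-1) s t) \<in> Bil_minus \<gamma> Sp Sm"
    by (intro Bil_minus_lincomb[OF \<Delta> \<Delta>]) simp_all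
  then show ?thesis by (simp add: \<Delta>_def field_simps)
qed

text \<open>The span of the admissible forms is thereby described by an identity that mentions neither
  types nor semi-spinors, and this identity is the one that the Jacobi identity produces. The
  nontrivial direction splits a form into its symmetric and its skew part.\<close>

lemma Bil_minus_iff:
  fixes \<gamma> :: "'e::euclidean_space \<Rightarrow> 's::real_vector \<Rightarrow> 's"
  assumes cm: "clifford_module neg_inner \<gamma>"
    and semi: "\<not> irreducible_on (so_ops \<gamma>) UNIV \<Longrightarrow> semi_spinors \<gamma> Sp Sm"
  shows "\<Gamma> \<in> Bil_minus \<gamma> Sp Sm \<longleftrightarrow> clifford_skew \<gamma> \<Gamma>"
proof
  assume sk: "clifford_skew \<gamma> \<Gamma>"
  have bil: "bilinear \<Gamma>" and 1: "\<And>v s t. \<Gamma> (\<gamma> v s) t = - \<Gamma> (\<gamma> v t) s"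
    using sk unfolding clifford_skew_def by blast+
  have 2: "\<And>v s t. \<Gamma> s (\<gamma> v t) = - \<Gamma> t (\<gamma> v s)"
    by (rule clifford_skew_transpose[OF cm sk])
  (* Combining the identities for the form and its transpose with sign c shows that symmetry
     type c comes with Clifford type -c. *)
  let ?\<Delta> = "\<lambda>c s t. 1 * \<Gamma> s t + c * \<Gamma> t s"
  have \<Delta>: "?\<Delta> c \<in> Bil_minus \<gamma> Sp Sm" if c: "c \<in> {1, -1}" for c
  proof (rule symmetric_types_in_Bil_minus[OF _ semi, where \<tau> = "- c" and \<sigma> = c])
    show "bilinear \<gamma>" using cm by (simp add: clifford_module_def)
    show "bilinear (?\<Delta> c)"
      by (rule bilinear_real_lincomb[OF bil bilinear_flip[OF bil]])
    show "?\<Delta> c (\<gamma> v s) t = - c * ?\<Delta> c s (\<gamma> v t)" for v s t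
      using 1[of v s t] 2[of t v s] c by auto
  qed (use c in auto)
  have "(\<lambda>s t. (1/2) * ?\<Delta> 1 s t + (1/2) * ?\<Delta> (-1) s t) \<in> Bil_minus \<gamma> Sp Sm"
    by (intro Bil_minus_lincomb[OF \<Delta> \<Delta>]) simp_all
  then show "\<Gamma> \<in> Bil_minus \<gamma> Sp Sm" by (simp add: field_simps)
qed (rule Bil_minus_clifford_skew)

section \<open>Brackets on the Heisenberg algebra and spinors\<close>

lemma flat_sharp [simp]: "flat (sharp \<alpha>) = \<alpha>"
  unfolding sharp_def by (rule surj_f_inv_f[OF bij_is_surj[OF bij_flat]])

lemma linear_sharp: "linear (sharp :: ('e::euclidean_space \<Rightarrow>\<^sub>L real) \<Rightarrow> 'e)"
proof -
  have "flat (x + y) = flat x + flat y" "flat (c *\<^sub>R x) = c *\<^sub>R flat x" for x y :: 'e and c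
    by (auto intro!: blinfun_eqI
        simp: flat.rep_eq neg_inner_def inner_simps blinfun.add_left blinfun.scaleR_left)
  then show ?thesis
    by (intro linearI) (metis sharp_flat flat_sharp)+
qed

text \<open>The upper right block of the action of the even part. The summand for \<open>\<alpha> \<in> E^*\<close> is
  dictated by the spin condition, since \<open>\<alpha> = flat (sharp \<alpha>)\<close>.\<close>

definition spin_block ::
    "('e::euclidean_space \<Rightarrow> 's::real_vector \<Rightarrow> 's) \<Rightarrow> ('e \<Rightarrow> 'e) \<Rightarrow> ('e \<Rightarrow> 's \<Rightarrow> 's) \<Rightarrow> 'e heis \<Rightarrow> 's \<Rightarrow> 's"
  where "spin_block \<gamma> B \<rho> = (\<lambda>(\<alpha>, e, c) s. sqrt 2 *\<^sub>R \<gamma> (B (sharp \<alpha>)) s + \<rho> e s)"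

text \<open>The arguments \<open>m\<close> and \<open>p\<close> stand for the components \<open>p_-+\<close> and \<open>p_++\<close> of the symmetric form
  on spinors, whose third component \<open>p_--\<close> is zero.\<close>

definition super_bracket ::
    "('e::euclidean_space \<Rightarrow> 'e \<Rightarrow> real) \<Rightarrow> ('e heis \<Rightarrow> 's::real_vector \<Rightarrow> 's) \<Rightarrow>
     ('s \<Rightarrow> 's \<Rightarrow> real) \<Rightarrow> ('s \<Rightarrow> 's \<Rightarrow> real) \<Rightarrow>
     'e heis \<times> ('s \<times> 's) \<Rightarrow> 'e heis \<times> ('s \<times> 's) \<Rightarrow> 'e heis \<times> ('s \<times> 's)"
  where "super_bracket b r m p = (\<lambda>(x, s, t) (x', s', t').
    (heis_bracket b x x' + (m s t' + m s' t + p t t') *\<^sub>R heis_p, (r x t' - r x' t, 0)))"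

lemma bilinear_heis_bracket:
  assumes "bilinear b"
  shows "bilinear (heis_bracket b)"
  unfolding bilinear_def heis_bracket_def
  by (auto intro!: linearI split: prod.splits
      simp: linear_add[OF linear_sharp] linear_scale[OF linear_sharp] bilinear_ladd[OF assms]
        bilinear_radd[OF assms] bilinear_lmul[OF assms] bilinear_rmul[OF assms] algebra_simps)

lemma heis_bracket_p:
  assumes "bilinear b"
  shows "heis_bracket b heis_p x = 0" "heis_bracket b x heis_p = 0"
  by (simp_all add: heis_bracket_def heis_p_def split_beta zero_prod_def linear_0[OF linear_sharp]
      bilinear_lzero[OF assms] bilinear_rzero[OF assms])

lemma bilinear_spin_block:
  assumes "bilinear \<gamma>" "linear B" "bilinear \<rho>"
  shows "bilinear (spin_block \<gamma> B \<rho>)"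
  unfolding bilinear_def spin_block_def
  by (auto intro!: linearI
      simp: linear_add[OF linear_sharp] linear_scale[OF linear_sharp]
        linear_add[OF assms(2)] linear_scale[OF assms(2)]
        bilinear_ladd[OF assms(1)] bilinear_radd[OF assms(1)] bilinear_lmul[OF assms(1)]
        bilinear_rmul[OF assms(1)] bilinear_ladd[OF assms(3)] bilinear_radd[OF assms(3)]
        bilinear_lmul[OF assms(3)] bilinear_rmul[OF assms(3)] algebra_simps)

text \<open>Double brackets have a component along \<open>p\<close> only, and it is a combination of terms
  \<open>m (r x s) t\<close>. In each combination of parities at most two such terms survive on the two sides
  of the Jacobi identity, and they are related by exchanging \<open>s\<close> and \<open>t\<close>.\<close>

lemma lie_superalgebra_super_bracket:
  fixes b :: "'e::euclidean_space \<Rightarrow> 'e \<Rightarrow> real" and r :: "'e heis \<Rightarrow> 's::real_vector \<Rightarrow> 's"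
  assumes b: "bilinear b" and r: "bilinear r" "\<And>s. r heis_p s = 0"
    and m: "bilinear m" and p: "bilinear p" "\<And>s t. p s t = p t s"
    and skew: "\<And>x s t. m (r x s) t = - m (r x t) s"
  shows "lie_superalgebra (super_bracket b r m p)"
  unfolding lie_superalgebra_def
proof (intro conjI allI ballI)
  note bs = bilinear_ladd[OF m] bilinear_radd[OF m] bilinear_lmul[OF m] bilinear_rmul[OF m]
    bilinear_lzero[OF m] bilinear_rzero[OF m] bilinear_lneg[OF m] bilinear_lsub[OF m]
    bilinear_ladd[OF p(1)] bilinear_radd[OF p(1)] bilinear_lmul[OF p(1)] bilinear_rmul[OF p(1)]
    bilinear_lzero[OF p(1)] bilinear_rzero[OF p(1)]
    bilinear_ladd[OF r(1)] bilinear_radd[OF r(1)] bilinear_lmul[OF r(1)] bilinear_rmul[OF r(1)]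
    bilinear_lzero[OF r(1)] bilinear_rzero[OF r(1)]
  note hs = bilinear_heis_bracket[OF b]
  note hbs = bilinear_ladd[OF hs] bilinear_radd[OF hs] bilinear_lmul[OF hs] bilinear_rmul[OF hs]
    bilinear_lzero[OF hs] bilinear_rzero[OF hs]
  let ?br = "super_bracket b r m p"
  show "bilinear ?br"
    unfolding bilinear_def
    by (intro conjI allI linearI; simp add: super_bracket_def split_beta prod_eq_iff[where ?'a = "'e heis"]
        bs hbs algebra_simps)
  have anti: "heis_bracket b x y = - heis_bracket b y x" for x y
    by (auto simp: heis_bracket_def algebra_simps split: prod.splits)
  have hp: "\<exists>c. heis_bracket b x y = c *\<^sub>R heis_p" for x y
    by (auto simp: heis_bracket_def split: prod.splits)
  (* The first bracket lies in the span of p and S_-. Its p-component brackets trivially, and its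
     S_- component is seen only through the pairing of S_- with S_+. *)
  have L: "?br (?br (x, s, t) (y, s', t')) (z, s'', t'')
      = (m (r x t' - r y t) t'' *\<^sub>R heis_p, 0, 0)" for x s t y s' t' z s'' t''
    using hp[of x y] by (auto simp: super_bracket_def hbs bs r(2) heis_bracket_p[OF b])
  have R: "?br (z, s'', t'') (?br (x, s, t) (y, s', t'))
      = (m (r x t' - r y t) t'' *\<^sub>R heis_p, 0, 0)" for x s t y s' t' z s'' t''
    using hp[of x y] by (auto simp: super_bracket_def hbs bs r(2) heis_bracket_p[OF b])
  fix i j :: nat and x y :: "'e heis \<times> 's \<times> 's"
  assume x: "x \<in> homogeneous i" and y: "y \<in> homogeneous j"
  obtain x0 s t y0 s' t' where e: "x = (x0, s, t)" "y = (y0, s', t')" by (metis prod.exhaust)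
  have pair0: "(u, v) = 0 \<longleftrightarrow> u = 0 \<and> v = 0" for u v :: 's
    by (simp add: zero_prod_def)
  show "?br x y \<in> homogeneous (i + j)"
    using x y unfolding e
    by (auto simp: homogeneous_def super_bracket_def hbs bs pair0 split: if_splits)
  show "?br x y = - ((-1) ^ (i * j) *\<^sub>R ?br y x)"
    using x y anti[of x0 y0] p(2)[of t t'] unfolding e
    by (auto simp: homogeneous_def super_bracket_def hbs bs pair0 algebra_simps split: if_splits)
  fix z :: "'e heis \<times> 's \<times> 's"
  obtain z0 s'' t'' where z: "z = (z0, s'', t'')" by (metis prod.exhaust)
  have jacobi: "m (r y0 t'' - r z0 t') t
      = m (r x0 t' - r y0 t) t'' + (-1) ^ (i * j) * m (r x0 t'' - r z0 t) t'"
  proof -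
    have "even i \<and> t = 0 \<or> odd i \<and> x0 = 0" "even j \<and> t' = 0 \<or> odd j \<and> y0 = 0"
      using x y unfolding e homogeneous_def by (auto simp: pair0 split: if_splits)
    moreover note skew[of x0 t' t''] skew[of y0 t t''] skew[of z0 t t']
    ultimately show ?thesis by (elim disjE) (simp_all add: bs)
  qed
  show "?br x (?br y z) = ?br (?br x y) z + (-1) ^ (i * j) *\<^sub>R ?br y (?br x z)"
    unfolding e z L R jacobi by (simp only: scaleR_add_left scaleR_scaleR scaleR_Pair add_Pair) simp
qed

text \<open>Separates the invariance condition into its components along \<open>E^*\<close> and \<open>E\<close>. As \<open>B\<close> is onto,
  the vectors \<open>B (sharp \<alpha>)\<close> exhaust \<open>E\<close>, so the first component no longer involves \<open>B\<close>.\<close>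

lemma skew_spin_block_iff:
  fixes \<gamma> :: "'e::euclidean_space \<Rightarrow> 's::real_vector \<Rightarrow> 's" and \<rho> :: "'e \<Rightarrow> 's \<Rightarrow> 's"
  assumes lin: "bilinear \<gamma>" "linear B" "bilinear \<rho>" and B: "surj B" and m: "bilinear m"
  shows "(\<forall>x s t. m (spin_block \<gamma> B \<rho> x s) t = - m (spin_block \<gamma> B \<rho> x t) s) \<longleftrightarrow>
    clifford_skew \<gamma> m \<and> (\<forall>e s t. m (\<rho> e s) t = - m (\<rho> e t) s)"
    (is "(\<forall>x. ?sk x) \<longleftrightarrow> _")
proof
  note ms = bilinear_ladd[OF m] bilinear_lmul[OF m]
  show "\<forall>x. ?sk x" if "clifford_skew \<gamma> m \<and> (\<forall>e s t. m (\<rho> e s) t = - m (\<rho> e t) s)"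
  proof (intro allI)
    fix x :: "'e heis" and s t
    obtain \<alpha> e c where x: "x = (\<alpha>, e, c)" by (metis prod.exhaust)
    have "m (\<gamma> (B (sharp \<alpha>)) s) t = - m (\<gamma> (B (sharp \<alpha>)) t) s" "m (\<rho> e s) t = - m (\<rho> e t) s"
      using that unfolding clifford_skew_def by blast+
    then show "m (spin_block \<gamma> B \<rho> x s) t = - m (spin_block \<gamma> B \<rho> x t) s"
      by (simp add: x spin_block_def ms)
  qed
  assume sk: "\<forall>x. ?sk x"
  have "m (\<gamma> v s) t = - m (\<gamma> v t) s" for v s t
  proof -
    obtain e where "v = B e" using B by (metis surjD)
    then have "sqrt 2 * m (\<gamma> v s) t = sqrt 2 * - m (\<gamma> v t) s"
      using sk[rule_format, of "(flat e, 0, 0)" s t]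
      by (simp add: spin_block_def ms bilinear_lzero[OF lin(3)])
    then show ?thesis by (simp only: mult_cancel_left) simp
  qed
  moreover have "m (\<rho> e s) t = - m (\<rho> e t) s" for e s t
    using sk[rule_format, of "(0, e, 0)" s t]
    by (simp add: spin_block_def ms linear_0[OF linear_sharp] linear_0[OF lin(2)] bilinear_lzero[OF lin(1)])
  ultimately show "clifford_skew \<gamma> m \<and> (\<forall>e s t. m (\<rho> e s) t = - m (\<rho> e t) s)"
    using m unfolding clifford_skew_def by blast
qed

section \<open>Correspondence between superizations and their data\<close>

lemma super_bracket_data:
  assumes "bilinear b" "bilinear \<gamma>" "linear B" "bilinear \<rho>" "bilinear m" "bilinear p"
  shows "rho12_of (super_bracket b (spin_block \<gamma> B \<rho>) m p) = \<rho>"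
    and "p_minus_plus (super_bracket b (spin_block \<gamma> B \<rho>) m p) = m"
    and "p_plus_plus (super_bracket b (spin_block \<gamma> B \<rho>) m p) = p"
  by (auto intro!: ext simp: rho12_of_def ad_odd_def p_minus_plus_def p_plus_plus_def p_form_def
      super_bracket_def spin_block_def heis_p_def heis_bracket_def zero_prod_def
      linear_0[OF linear_sharp] linear_0[OF assms(3)] assms(1,2,4-)[THEN bilinear_lzero]
      assms(1,2,4-)[THEN bilinear_rzero])

lemma super_bracket_special:
  fixes \<gamma> :: "'e::euclidean_space \<Rightarrow> 's::real_vector \<Rightarrow> 's" and \<rho> :: "'e \<Rightarrow> 's \<Rightarrow> 's"
  assumes b: "bilinear b" and lin: "bilinear \<gamma>" "linear B" "bilinear \<rho>" and B: "surj B"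
    and m: "clifford_skew \<gamma> m" "\<forall>e s t. m (\<rho> e s) t = - m (\<rho> e t) s"
    and p: "bilinear p" "\<And>s t. p s t = p t s"
  shows "super_bracket b (spin_block \<gamma> B \<rho>) m p \<in> special_superizations \<gamma> b B"
proof -
  let ?r = "spin_block \<gamma> B \<rho>" and ?br = "super_bracket b (spin_block \<gamma> B \<rho>) m p"
  have mb: "bilinear m" using m(1) by (simp add: clifford_skew_def)
  note r = bilinear_spin_block[OF lin]
  note zs = linear_0[OF linear_sharp] linear_0[OF lin(2)] bilinear_lzero[OF lin(1)]
    bilinear_lzero[OF lin(3)] bilinear_lzero[OF mb] bilinear_rzero[OF mb]
    bilinear_lzero[OF p(1)] bilinear_rzero[OF p(1)] bilinear_lzero[OF r] bilinear_rzero[OF r]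
    bilinear_lzero[OF bilinear_heis_bracket[OF b]] bilinear_rzero[OF bilinear_heis_bracket[OF b]]
  have rp: "?r heis_p s = 0" for s
    by (simp add: spin_block_def heis_p_def zs)
  have ad: "ad_odd ?br x = upper_right (?r x)" for x
    by (auto intro!: ext simp: ad_odd_def super_bracket_def upper_right_def zs zero_prod_def)
  have "lie_superalgebra ?br"
    using skew_spin_block_iff[OF lin B mb] m
    by (intro lie_superalgebra_super_bracket b r rp mb p) blast
  moreover have "?br (x, 0) (y, 0) = (heis_bracket b x y, 0)" for x y
    by (simp add: super_bracket_def zs zero_prod_def[where ?'a='s and ?'b='s])
  moreover have "spin_rep \<gamma> B (ad_odd ?br)"
    unfolding spin_rep_def ad by (simp add: spin_block_def zs)
  moreover have "zero_charge (ad_odd ?br)"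
    using rp by (auto simp: zero_charge_def ad upper_right_def zero_prod_def)
  moreover have "ad_odd ?br (0, e, 0) = upper_right (\<rho> e)" for e
    unfolding ad by (simp add: spin_block_def zs)
  moreover define P where "P Q Q' = m (fst Q) (snd Q') + m (fst Q') (snd Q) + p (snd Q) (snd Q')" for Q Q'
  have "bilinear P"
    unfolding bilinear_def P_def
    by (auto intro!: linearI simp: bilinear_ladd[OF mb] bilinear_radd[OF mb] bilinear_lmul[OF mb]
        bilinear_rmul[OF mb] bilinear_ladd[OF p(1)] bilinear_radd[OF p(1)] bilinear_lmul[OF p(1)]
        bilinear_rmul[OF p(1)] algebra_simps)
  moreover have "P Q Q' = P Q' Q" for Q Q'
    using p(2)[of "snd Q" "snd Q'"] by (simp add: P_def)
  moreover have "?br (0, Q) (0, Q') = (P Q Q' *\<^sub>R heis_p, 0)" for Q Q'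
    by (simp add: super_bracket_def split_beta P_def zs zero_prod_def[where ?'a='s and ?'b='s])
  ultimately show ?thesis
    using lin(3) unfolding special_superizations_def superization_def by blast
qed

text \<open>The converse reads everything off the Jacobi identity for one even and two odd elements. It is
  used first to remove the component \<open>p_--\<close>, which leaves only the data that enter
  \<open>super_bracket\<close>, and then to obtain the skewness conditions.\<close>

lemma special_superization_eq_super_bracket:
  fixes \<gamma> :: "'e::euclidean_space \<Rightarrow> 's::real_vector \<Rightarrow> 's"
  assumes b: "bilinear b" and cm: "clifford_module neg_inner \<gamma>" and B: "linear B" "surj B"
    and br: "br \<in> special_superizations \<gamma> b B"
  defines "\<rho> \<equiv> rho12_of br" and "m \<equiv> p_minus_plus br" and "p \<equiv> p_plus_plus br"
  shows "br = super_bracket b (spin_block \<gamma> B \<rho>) m p"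
    and "bilinear \<rho>" and "clifford_skew \<gamma> m" and "\<And>e s t. m (\<rho> e s) t = - m (\<rho> e t) s"
    and "bilinear p" and "\<And>s t. p s t = p t s"
proof -
  have \<gamma>: "bilinear \<gamma>" and sq: "\<gamma> v (\<gamma> v s) = (v \<bullet> v) *\<^sub>R s" for v s
    using cm by (simp_all add: clifford_module_def neg_inner_def)
  obtain \<rho>' P where L: "lie_superalgebra br"
    and even: "\<And>x y. br (x, 0) (y, 0) = (heis_bracket b x y, 0)"
    and spin: "\<And>e. ad_odd br (flat e, 0, 0) = upper_right (\<lambda>s. sqrt 2 *\<^sub>R \<gamma> (B e) s)"
    and zc: "ad_odd br heis_p = (\<lambda>Q. 0)"
    and \<rho>': "bilinear \<rho>'" "\<And>e. ad_odd br (0, e, 0) = upper_right (\<rho>' e)"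
    and P: "bilinear P" "\<And>Q Q'. P Q Q' = P Q' Q" "\<And>Q Q'. br (0, Q) (0, Q') = (P Q Q' *\<^sub>R heis_p, 0)"
    using br unfolding special_superizations_def superization_def spin_rep_def zero_charge_def by blast
  have \<rho>_eq: "\<rho> = \<rho>'"
    by (auto intro!: ext simp: \<rho>_def rho12_of_def \<rho>'(2) upper_right_def)
  show \<rho>: "bilinear \<rho>" unfolding \<rho>_eq by (rule \<rho>'(1))
  have P_form: "p_form br = P"
    by (auto intro!: ext simp: p_form_def P(3) heis_p_def)
  have m: "m = (\<lambda>s t. P (s, 0) (0, t))" and p: "p = (\<lambda>s t. P (0, s) (0, t))"
    by (auto intro!: ext simp: m_def p_def p_minus_plus_def p_plus_plus_def P_form)
  have inj: "linear (\<lambda>s::'s. (s, 0::'s))" "linear (\<lambda>s::'s. (0::'s, s))"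
    by (auto intro!: linearI)
  show "bilinear p" unfolding p by (rule bilinear_compose_linear[OF P(1) inj(2) inj(2)])
  show "p s t = p t s" for s t unfolding p by (rule P(2))
  have mb: "bilinear m" unfolding m by (rule bilinear_compose_linear[OF P(1) inj(1) inj(2)])
  let ?r = "spin_block \<gamma> B \<rho>"
  have bil: "bilinear br" using L by (simp add: lie_superalgebra_def)
  note bb = bilinear_ladd[OF bil] bilinear_radd[OF bil] bilinear_lmul[OF bil] bilinear_rmul[OF bil]
  have hom: "(x, 0) \<in> homogeneous 0" "(0, Q) \<in> homogeneous (Suc 0)"
    for x :: "'e heis" and Q :: "'s \<times> 's"
    by (simp_all add: homogeneous_def)
  have ad: "ad_odd br x = upper_right (?r x)" for x
  proof (rule ext)
    fix Q
    obtain \<alpha> e c where x: "x = (\<alpha>, e, c)" by (metis prod.exhaust)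
    have "(x, 0) = ((flat (sharp \<alpha>), 0, 0), 0) + ((0, e, 0), 0) + c *\<^sub>R (heis_p, 0::'s \<times> 's)"
      by (simp add: x heis_p_def)
    then have "ad_odd br x Q = ad_odd br (flat (sharp \<alpha>), 0, 0) Q + ad_odd br (0, e, 0) Q
        + c *\<^sub>R ad_odd br heis_p Q"
      unfolding ad_odd_def by (simp only: bb snd_add snd_scaleR)
    then show "ad_odd br x Q = upper_right (?r x) Q"
      unfolding spin \<rho>'(2) zc by (simp add: upper_right_def x spin_block_def \<rho>_eq)
  qed
  have eo: "br (x, 0) (0, Q) = (0, ?r x (snd Q), 0)" for x Q
  proof -
    have "br (x, 0) (0, Q) \<in> homogeneous (0 + Suc 0)"
      using L hom unfolding lie_superalgebra_def by blast
    then have "br (x, 0) (0, Q) = (0, ad_odd br x Q)"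
      by (simp add: homogeneous_def ad_odd_def prod_eq_iff)
    then show ?thesis by (simp add: ad upper_right_def)
  qed
  have oe: "br (0, Q) (x, 0) = - br (x, 0) (0, Q)" for x Q
  proof -
    have "br (0, Q) (x, 0) = - ((-1) ^ (Suc 0 * 0) *\<^sub>R br (x, 0) (0, Q))"
      using L hom unfolding lie_superalgebra_def by blast
    then show ?thesis by simp
  qed
  (* The bracket of x with the central element [Q, Q'] vanishes, so P is invariant. *)
  have inv: "P (?r x t, 0) (s', t') + P (s, t) (?r x t', 0) = 0" for x s t s' t'
  proof -
    have "br (x, 0) (br (0, s, t) (0, s', t')) = br (br (x, 0) (0, s, t)) (0, s', t')
        + (-1) ^ (0 * Suc 0) *\<^sub>R br (0, s, t) (br (x, 0) (0, s', t'))"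
      using L hom(1)[of x] hom(2)[of "(s, t)"] unfolding lie_superalgebra_def by blast
    then have "0 = (P (?r x t, 0) (s', t') + P (s, t) (?r x t', 0)) *\<^sub>R (heis_p :: 'e heis)"
      by (simp add: eo P(3) even heis_bracket_p[OF b] bilinear_rmul[OF bilinear_heis_bracket[OF b]]
          scaleR_add_left)
    then show ?thesis by (simp add: heis_p_def zero_prod_def)
  qed
  (* Every element of S_- is the image under E^* of an element of S_+, because unit vectors act
     by involutions; invariance moves this operator to the other argument, where it is zero. *)
  have minus: "P (s, 0) (s', 0) = 0" for s s'
  proof -
    obtain u :: 'e where "u \<in> Basis" by (meson nonempty_Basis ex_in_conv)
    then have u: "\<gamma> u (\<gamma> u s') = s'" using sq[of u s'] by simp
    obtain e where e: "B e = u" using B(2) by (metis surjD)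
    have "P (s, 0) (?r (flat e, 0, 0) (\<gamma> u s'), 0) = 0"
      using inv[of "(flat e, 0, 0)" 0 0 "\<gamma> u s'" s] bilinear_rzero[OF bilinear_spin_block[OF \<gamma> B(1) \<rho>]]
        bilinear_lzero[OF P(1)] by (simp add: zero_prod_def)
    moreover have "(?r (flat e, 0, 0) (\<gamma> u s'), 0 :: 's) = sqrt 2 *\<^sub>R (s', 0)"
      by (simp add: spin_block_def e u bilinear_lzero[OF \<rho>])
    ultimately show ?thesis by (simp add: bilinear_rmul[OF P(1)] del: scaleR_Pair)
  qed
  have "m (?r x s) t = - m (?r x t) s" for x s t
    using inv[of x s 0 t 0] P(2) by (simp add: m)
  then have "\<forall>x s t. m (?r x s) t = - m (?r x t) s" by blast
  then have "clifford_skew \<gamma> m \<and> (\<forall>e s t. m (\<rho> e s) t = - m (\<rho> e t) s)"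
    using skew_spin_block_iff[OF \<gamma> B(1) \<rho> B(2) mb] by blast
  then show "clifford_skew \<gamma> m" "\<And>e s t. m (\<rho> e s) t = - m (\<rho> e t) s" by blast+
  have P_eq: "P (s, t) (s', t') = m s t' + m s' t + p t t'" for s t s' t'
  proof -
    have "P (s, t) (s', t') = P ((s, 0) + (0, t)) ((s', 0) + (0, t'))" by simp
    also have "\<dots> = P (s, 0) (s', 0) + m s t' + P (0, t) (s', 0) + p t t'"
      by (simp only: bilinear_ladd[OF P(1)] bilinear_radd[OF P(1)] m p)
    finally show ?thesis using P(2)[of "(0, t)" "(s', 0)"] by (simp add: minus m)
  qed
  show "br = super_bracket b ?r m p"
  proof (intro ext)
    fix X Y :: "'e heis \<times> 's \<times> 's"
    obtain x s t y s' t' where e: "X = (x, s, t)" "Y = (y, s', t')" by (metis prod.exhaust)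
    have "br X Y = br ((x, 0) + (0, s, t)) ((y, 0) + (0, s', t'))" by (simp add: e)
    also have "\<dots> = br (x, 0) (y, 0) + br (x, 0) (0, s', t') + br (0, s, t) (y, 0) + br (0, s, t) (0, s', t')"
      by (simp only: bb add_ac)
    also have "\<dots> = super_bracket b ?r m p X Y"
      by (simp add: oe even eo P(3) P_eq super_bracket_def e)
    finally show "br X Y = super_bracket b ?r m p X Y" .
  qed
qed

theorem proposition3p2:
  fixes b :: "'e::euclidean_space \<Rightarrow> 'e \<Rightarrow> real"
    and B :: "'e \<Rightarrow> 'e"
    and \<gamma> :: "'e \<Rightarrow> 's::real_vector \<Rightarrow> 's"
    and Sp Sm :: "'s set"
    and \<delta> :: "'e mink \<Rightarrow> 's \<times> 's \<Rightarrow> 's \<times> 's"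
  assumes b: "nondeg_sym_bilinear b"
    and B: "linear B" "\<And>x y. b x y = - neg_inner (B x) y"
    and S0: "irreducible_clifford_module neg_inner \<gamma>"
    and semi: "\<not> irreducible_on (so_ops \<gamma>) UNIV \<Longrightarrow> semi_spinors \<gamma> Sp Sm"
    and S: "minkowski_spinors \<gamma> \<delta>"
  shows "bij_betw (\<lambda>br. (rho12_of br, p_minus_plus br, p_plus_plus br))
    (special_superizations \<gamma> b B)
    {(\<rho>12, p_mp, p_pp).
       bilinear \<rho>12 \<and> p_mp \<in> Bil_minus \<gamma> Sp Sm \<and>
       bilinear p_pp \<and> (\<forall>s t. p_pp s t = p_pp t s) \<and>
       (\<forall>e s t. p_mp (\<rho>12 e s) t = - p_mp (\<rho>12 e t) s)}"
proof -
  have bil: "bilinear b" using b by (simp add: nondeg_sym_bilinear_def)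
  have cm: "clifford_module neg_inner \<gamma>" using S0 by (simp add: irreducible_clifford_module_def)
  then have \<gamma>: "bilinear \<gamma>" by (simp add: clifford_module_def)
  have "x = 0" if "B x = 0" for x
    using b that unfolding nondeg_sym_bilinear_def by (simp add: B(2) neg_inner_def)
  then have "surj B"
    using B(1) by (intro linear_injective_imp_surjective) (auto simp: linear_injective_0)
  have Bil: "m \<in> Bil_minus \<gamma> Sp Sm \<longleftrightarrow> clifford_skew \<gamma> m" for m
    using cm semi by (rule Bil_minus_iff)
  let ?br = "\<lambda>(\<rho>, m, p). super_bracket b (spin_block \<gamma> B \<rho>) m p"
  let ?data = "{(\<rho>12 :: 'e \<Rightarrow> 's \<Rightarrow> 's, p_mp, p_pp :: 's \<Rightarrow> 's \<Rightarrow> real).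
       bilinear \<rho>12 \<and> p_mp \<in> Bil_minus \<gamma> Sp Sm \<and>
       bilinear p_pp \<and> (\<forall>s t. p_pp s t = p_pp t s) \<and>
       (\<forall>e s t. p_mp (\<rho>12 e s) t = - p_mp (\<rho>12 e t) s)}"
  show ?thesis
  proof (rule bij_betw_byWitness[where f' = ?br]; (intro ballI subsetI)?)
    fix br assume "br \<in> special_superizations \<gamma> b B"
    from special_superization_eq_super_bracket(1)[OF bil cm B(1) \<open>surj B\<close> this]
    show "?br (rho12_of br, p_minus_plus br, p_plus_plus br) = br" by simp
  next
    fix d assume "d \<in> ?data"
    moreover obtain \<rho> m p where d: "d = (\<rho>, m, p)" by (metis prod.exhaust)
    ultimately have "bilinear \<rho> \<and> clifford_skew \<gamma> m \<and> bilinear p"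
      unfolding d Bil mem_Collect_eq prod.case by blast
    then have "bilinear \<rho>" "bilinear m" "bilinear p"
      by (simp_all add: clifford_skew_def)
    then show "(rho12_of (?br d), p_minus_plus (?br d), p_plus_plus (?br d)) = d"
      using super_bracket_data[OF bil \<gamma> B(1)] by (simp add: d)
  next
    fix d assume "d \<in> (\<lambda>br. (rho12_of br, p_minus_plus br, p_plus_plus br)) ` special_superizations \<gamma> b B"
    then obtain br where d: "d = (rho12_of br, p_minus_plus br, p_plus_plus br)"
      and br: "br \<in> special_superizations \<gamma> b B" by blast
    show "d \<in> ?data"
      using special_superization_eq_super_bracket(2-)[OF bil cm B(1) \<open>surj B\<close> br]
      unfolding d Bil mem_Collect_eq prod.case by blast
  next
    fix br assume "br \<in> ?br ` ?data"
    then obtain d where "d \<in> ?data" and br: "br = ?br d" by blast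
    moreover obtain \<rho> m p where d: "d = (\<rho>, m, p)" by (metis prod.exhaust)
    ultimately have "bilinear \<rho>" "clifford_skew \<gamma> m" "\<forall>e s t. m (\<rho> e s) t = - m (\<rho> e t) s"
      "bilinear p" "\<And>s t. p s t = p t s"
      unfolding d Bil mem_Collect_eq prod.case by blast+
    from super_bracket_special[OF bil \<gamma> B(1) this(1) \<open>surj B\<close> this(2-)]
    show "br \<in> special_superizations \<gamma> b B" by (simp add: br d)
  qed
qed

end
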